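(* Let $A=(a_{j,k})$ be a non-negative $n\times\infty$ matrix and let $x=\{x_k\}_{k=1}^\infty\ge0$ (that is, $x_k\ge0$ for all $k$). Then there exists some $B=(b_{j,k})\in\bigcup_{0\le\gamma\le\lambda\le n}\mathcal R_A^{\gamma,\lambda}$, depending on $A$ and $x$, such that the sequence $Bx=\left\{\sum_{k=1}^\infty b_{j,k}x_k\right\}_{j=1}^n$ is decreasing.
   Context: A sequence is decreasing if each term is greater than or equal to the next. For an $n\times\infty$ matrix $A=(a_{j,k})$ ($1\le j\le n$, $1\le k<\infty$), an $n\times\infty$ matrix $B=(b_{j,k})$ is said to be obtained from $A$ by row rearrangements if there is a one-to-one mapping $\sigma$ from $\{1,2,\dots,n\}$ onto itself with $b_{j,k}=a_{\sigma(j),k}$ for all $j$ and all $k$; $\mathcal R_A$ denotes the collection of these matrices. For integers $0\le\gamma\le\lambda\le n$, $\mathcal R_A^{\gamma,\lambda}$ is the set of all $B=(b_{j,k})\in\mathcal R_A$ of the following form (row indices lie in $\{1,\dots,n\}$ and the inequalities are understood for all $k\ge1$): (i) $b_{j,k}\ge b_{j+1,k}$ for $j\le\gamma$ or $j\ge\lambda$; (ii) $b_{r_1,k}\ge b_{j,k}\ge b_{r_2,k}$ for $r_1\le\gamma<j<\lambda\le r_2$; (iii) no $\alpha$ with $\gamma<\alpha<\lambda$ possesses the property: $b_{\alpha,k}\ge b_{j,k}$ for all $\gamma<j<\lambda$, or $b_{\alpha,k}\le b_{j,k}$ for all $\gamma<j<\lambda$.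
   Formalization: The union is taken over 0 ≤ γ ≤ λ ≤ n+1 instead of λ ≤ n: as printed the claim fails for n = 2 with rows (1,0,0,…) and (0,1,0,…), where the union is empty; inequalities in (ii) above and below the middle block are required separately. *)

theory Defs
  imports "HOL-Library.Extended_Nonnegative_Real"
begin

text \<open>
  An \<open>n \<times> \<infinity>\<close> matrix is a function \<open>nat \<Rightarrow> nat \<Rightarrow> real\<close> of which only the entries
  with row index in \<open>{1..n}\<close> and column index \<open>\<ge> 1\<close> are meaningful.
\<close>

type_synonym matrix = "nat \<Rightarrow> nat \<Rightarrow> real"

definition nonneg_matrix :: "nat \<Rightarrow> matrix \<Rightarrow> bool" where
  "nonneg_matrix n A \<longleftrightarrow> (\<forall>j\<in>{1..n}. \<forall>k\<ge>1. 0 \<le> A j k)"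

definition row_rearrangements :: "nat \<Rightarrow> matrix \<Rightarrow> matrix set" where
  "row_rearrangements n A =
     {B. \<exists>\<sigma>. bij_betw \<sigma> {1..n} {1..n} \<and> (\<forall>j\<in>{1..n}. \<forall>k\<ge>1. B j k = A (\<sigma> j) k)}"

definition row_ge :: "matrix \<Rightarrow> nat \<Rightarrow> nat \<Rightarrow> bool" where
  "row_ge B i j \<longleftrightarrow> (\<forall>k\<ge>1. B i k \<ge> B j k)"

text \<open>
  The two inequalities of the second condition are required separately, so that for \<open>\<gamma> = 0\<close>
  (no \<open>r\<^sub>1\<close>) the rows from \<open>\<mu>\<close> on must still lie below the middle block, and dually.
  The set is meaningful for \<open>\<gamma> \<le> \<mu> \<le> n + 1\<close>; for \<open>\<mu> = n + 1\<close> there is no row below the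
  middle block \<open>{\<gamma><..<\<mu>}\<close>, just as for \<open>\<gamma> = 0\<close> there is none above it.
\<close>

definition ordered_rearrangements :: "nat \<Rightarrow> matrix \<Rightarrow> nat \<Rightarrow> nat \<Rightarrow> matrix set" where
  "ordered_rearrangements n A \<gamma> \<mu> =
     {B \<in> row_rearrangements n A.
        (\<forall>j. j \<in> {1..n} \<and> j + 1 \<in> {1..n} \<and> (j \<le> \<gamma> \<or> \<mu> \<le> j) \<longrightarrow> row_ge B j (j + 1)) \<and>
        (\<forall>j\<in>{1..n}. \<gamma> < j \<and> j < \<mu> \<longrightarrow>
           (\<forall>r\<^sub>1\<in>{1..n}. r\<^sub>1 \<le> \<gamma> \<longrightarrow> row_ge B r\<^sub>1 j) \<and>
           (\<forall>r\<^sub>2\<in>{1..n}. \<mu> \<le> r\<^sub>2 \<longrightarrow> row_ge B j r\<^sub>2)) \<and>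
        \<not> (\<exists>\<alpha>\<in>{1..n}. \<gamma> < \<alpha> \<and> \<alpha> < \<mu> \<and>
             ((\<forall>j\<in>{1..n}. \<gamma> < j \<and> j < \<mu> \<longrightarrow> row_ge B \<alpha> j) \<or>
              (\<forall>j\<in>{1..n}. \<gamma> < j \<and> j < \<mu> \<longrightarrow> row_ge B j \<alpha>)))}"

text \<open>
  If \<open>\<mu>\<close> were only allowed to range up to \<open>n\<close>, the middle block could never contain row \<open>n\<close>,
  and there would be no such rearrangement at all for two incomparable rows:
\<close>

lemma no_ordered_rearrangement_up_to_n:
  assumes "\<not> row_ge A 1 2" "\<not> row_ge A 2 1"
  shows "(\<Union>\<gamma>. \<Union>\<mu>\<in>{\<gamma>..2}. ordered_rearrangements 2 A \<gamma> \<mu>) = {}"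
proof -
  have False if B: "B \<in> ordered_rearrangements 2 A \<gamma> \<mu>" and l: "\<mu> \<le> 2" for B \<gamma> \<mu>
  proof -
    have s: "{1..2::nat} = {1, 2}" by auto
    obtain \<sigma> where bij: "bij_betw \<sigma> {1..2} {1..2::nat}"
      and eq: "\<And>j k. j \<in> {1..2} \<Longrightarrow> k \<ge> 1 \<Longrightarrow> B j k = A (\<sigma> j) k"
      using B by (auto simp: ordered_rearrangements_def row_rearrangements_def)
    have "\<sigma> 1 \<in> {1, 2}" "\<sigma> 2 \<in> {1, 2}" "\<sigma> 1 \<noteq> \<sigma> 2"
      using bij unfolding s bij_betw_def by auto
    moreover have "row_ge B 1 2 \<longleftrightarrow> row_ge A (\<sigma> 1) (\<sigma> 2)"
      using eq by (simp add: row_ge_def)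
    ultimately have n12: "\<not> row_ge B 1 2" using assms by auto
    have "(1 \<le> \<gamma> \<or> \<mu> \<le> 1) \<longrightarrow> row_ge B 1 2"
      using B by (auto simp: ordered_rearrangements_def numeral_2_eq_2)
    with n12 l have "\<gamma> = 0" "\<mu> = 2" by auto
    then show False
      using B unfolding ordered_rearrangements_def row_ge_def s by auto
  qed
  then show ?thesis by auto
qed

text \<open>
  Row sums of a non-negative matrix against a non-negative sequence may be infinite, so they
  are taken in \<open>[0, \<infinity>]\<close>. The shift by \<open>Suc\<close> makes the summation start at column 1.
\<close>

definition mat_apply :: "matrix \<Rightarrow> (nat \<Rightarrow> real) \<Rightarrow> nat \<Rightarrow> ennreal" where
  "mat_apply B x j = (\<Sum>k. ennreal (B j (Suc k) * x (Suc k)))"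

definition decreasing_upto :: "nat \<Rightarrow> (nat \<Rightarrow> ennreal) \<Rightarrow> bool" where
  "decreasing_upto n y \<longleftrightarrow> (\<forall>j. 1 \<le> j \<and> j < n \<longrightarrow> y j \<ge> y (j + 1))"

end

(* Peel off a row lying above all remaining rows, or one lying below all of them, as long as
   there is one; what is left forms the middle block and is sorted by the values of the row sums.
   A row that dominates another one entrywise has the larger row sum, so the peeled
   rows do not disturb the order. *)
theory Submission
  imports Defs
begin

text \<open>Induction on \<open>S\<close>: an element comparable in the same direction with all of
  \<open>S\<close> goes to the front of \<open>T\<close> or to the end of \<open>L\<close>. Pairs
  between \<open>T\<close> and \<open>L\<close> are put into \<open>sorted_wrt R (T @ L)\<close>
  because for empty \<open>M\<close> they could not be recovered by passing through
  \<open>M\<close>.\<close>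

lemma peel_extremal_elements:
  fixes R :: "'a \<Rightarrow> 'a \<Rightarrow> bool" and f :: "'a \<Rightarrow> 'b :: linorder"
  assumes "finite S"
  shows "\<exists>T M L. distinct (T @ M @ L) \<and> set (T @ M @ L) = S \<and> sorted_wrt R (T @ L) \<and>
           (\<forall>t\<in>set T. \<forall>m\<in>set M. R t m) \<and> (\<forall>m\<in>set M. \<forall>l\<in>set L. R m l) \<and>
           sorted_wrt (\<lambda>a b. f b \<le> f a) M \<and>
           \<not> (\<exists>a\<in>set M. (\<forall>m\<in>set M. R a m) \<or> (\<forall>m\<in>set M. R m a))"
  using assms
proof (induction S rule: finite_psubset_induct)
  case (psubset S)
  show ?case
  proof (cases "\<exists>a\<in>S. (\<forall>m\<in>S. R a m) \<or> (\<forall>m\<in>S. R m a)")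
    case True
    then obtain a where a: "a \<in> S" "(\<forall>m\<in>S. R a m) \<or> (\<forall>m\<in>S. R m a)" by blast
    have "S - {a} \<subset> S" using a by blast
    from psubset.IH[OF this] obtain T M L where
      d: "distinct (T @ M @ L)" and s: "set (T @ M @ L) = S - {a}"
      and r: "sorted_wrt R (T @ L)" "\<forall>t\<in>set T. \<forall>m\<in>set M. R t m"
        "\<forall>m\<in>set M. \<forall>l\<in>set L. R m l" "sorted_wrt (\<lambda>a b. f b \<le> f a) M"
        "\<not> (\<exists>a\<in>set M. (\<forall>m\<in>set M. R a m) \<or> (\<forall>m\<in>set M. R m a))"
      by blast
    have n: "a \<notin> set (T @ M @ L)" using s by blast
    have sub: "set T \<subseteq> S" "set M \<subseteq> S" "set L \<subseteq> S" and ins: "insert a (set (T @ M @ L)) = S"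
      using s a by auto
    from a(2) show ?thesis
    proof
      assume top: "\<forall>m\<in>S. R a m"
      have "distinct ((a # T) @ M @ L)" "set ((a # T) @ M @ L) = S"
        using d n ins by simp_all
      moreover have "sorted_wrt R ((a # T) @ L)"
        using r(1) top sub by auto
      moreover have "\<forall>t\<in>set (a # T). \<forall>m\<in>set M. R t m"
        using r(2) top sub by auto
      ultimately show ?thesis using r(3-5) by blast
    next
      assume bot: "\<forall>m\<in>S. R m a"
      have "distinct (T @ M @ (L @ [a]))" "set (T @ M @ (L @ [a])) = S"
        using d n ins by auto
      moreover have "sorted_wrt R (T @ (L @ [a]))"
        using r(1) bot sub by (auto simp: sorted_wrt_append)
      moreover have "\<forall>m\<in>set M. \<forall>l\<in>set (L @ [a]). R m l"
        using r(3) bot sub by auto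
      ultimately show ?thesis using r(2,4,5) by blast
    qed
  next
    case False
    obtain xs where xs: "set xs = S" "distinct xs"
      using finite_distinct_list[OF psubset.hyps] by blast
    have "sorted_wrt (\<lambda>a b. f b \<le> f a) (rev (sort_key f xs))"
      using sorted_sort_key[of f xs] by (simp add: sorted_wrt_rev sorted_map)
    \<comment> \<open>Nothing can be peeled, so \<open>T\<close> and \<open>L\<close> are empty and
      the whole of \<open>S\<close> becomes \<open>M\<close>. The condition on extremal elements is
      then the case assumption itself.\<close>
    then show ?thesis
      using xs False by (intro exI[of _ "[]"] exI[of _ "rev (sort_key f xs)"]) auto
  qed
qed

text \<open>The series are compared term by term. In \<open>ennreal\<close> every series is
  summable, so infinite row sums need no separate case.\<close>

lemma mat_apply_mono:
  assumes "row_ge A i j" and "\<forall>k\<ge>1. 0 \<le> x k"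
  shows "mat_apply A x j \<le> mat_apply A x i"
  unfolding mat_apply_def
  using assms by (intro suminf_le) (auto simp: row_ge_def intro!: ennreal_leI mult_right_mono)

theorem lemma2p3:
  fixes n :: nat and A :: matrix and x :: "nat \<Rightarrow> real"
  assumes "nonneg_matrix n A"
    and "\<forall>k\<ge>1. 0 \<le> x k"
  shows "\<exists>B \<in> (\<Union>\<gamma>. \<Union>\<mu>\<in>{\<gamma>..n + 1}. ordered_rearrangements n A \<gamma> \<mu>).
           decreasing_upto n (mat_apply B x)"
proof -
  \<comment> \<open>Row indices are peeled rather than rows, so that equal rows stay distinct
    elements.\<close>
  obtain T M L where d: "distinct (T @ M @ L)" and s: "set (T @ M @ L) = {1..n}"
    and TL: "sorted_wrt (row_ge A) (T @ L)"
    and T_above_M: "\<And>t m. t \<in> set T \<Longrightarrow> m \<in> set M \<Longrightarrow> row_ge A t m"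
    and M_above_L: "\<And>m l. m \<in> set M \<Longrightarrow> l \<in> set L \<Longrightarrow> row_ge A m l"
    and M: "sorted_wrt (\<lambda>a b. mat_apply A x b \<le> mat_apply A x a) M"
    and extr: "\<not> (\<exists>a\<in>set M. (\<forall>m\<in>set M. row_ge A a m) \<or> (\<forall>m\<in>set M. row_ge A m a))"
    using peel_extremal_elements[of "{1..n}" "row_ge A" "mat_apply A x"] by auto
  define zs where "zs = T @ M @ L"
  have len: "length zs = n"
    using distinct_card[OF d] s by (simp add: zs_def)
  \<comment> \<open>List positions start at 0 and row indices at 1, hence the shift.\<close>
  define \<sigma> where "\<sigma> j = zs ! (j - 1)" for j
  define B where "B j = A (\<sigma> j)" for j
  define \<gamma> where "\<gamma> = length T"
  \<comment> \<open>This is the index at which \<open>L\<close> starts; it equals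
    \<open>n + 1\<close> exactly when \<open>L\<close> is empty.\<close>
  define \<mu> where "\<mu> = length T + length M + 1"
  have n: "n = length T + length M + length L"
    using len by (simp add: zs_def)
  have bij: "bij_betw \<sigma> {1..n} {1..n}"
  proof -
    have "bij_betw (\<lambda>j. j - 1) {1..n} {..<n}"
      by (rule bij_betwI[where g = Suc]) auto
    moreover have "bij_betw ((!) zs) {..<n} {1..n}"
      using d s len by (intro bij_betw_nth) (auto simp: zs_def)
    ultimately have "bij_betw ((!) zs \<circ> (\<lambda>j. j - 1)) {1..n} {1..n}"
      by (rule bij_betw_trans)
    then show ?thesis by (simp add: \<sigma>_def[abs_def] comp_def)
  qed
  have row_B: "row_ge B i j \<longleftrightarrow> row_ge A (\<sigma> i) (\<sigma> j)" for i j
    by (simp add: row_ge_def B_def)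
  have sum_B: "mat_apply B x j = mat_apply A x (\<sigma> j)" for j
    by (simp add: mat_apply_def B_def)
  have inT: "\<sigma> j \<in> set T" if "1 \<le> j" "j \<le> \<gamma>" for j
    using that by (auto simp: \<sigma>_def zs_def \<gamma>_def nth_append)
  have inM: "\<sigma> j \<in> set M" if "\<gamma> < j" "j < \<mu>" for j
    using that by (auto simp: \<sigma>_def zs_def \<gamma>_def \<mu>_def nth_append)
  have inL: "\<sigma> j \<in> set L" if "\<mu> \<le> j" "j \<le> n" for j
    using that n by (auto simp: \<sigma>_def zs_def \<mu>_def nth_append)
  \<comment> \<open>The converse of \<open>inM\<close>: it lets a statement about all middle
    positions be read as one about all of \<open>M\<close>.\<close>
  have setM: "\<exists>j\<in>{1..n}. \<gamma> < j \<and> j < \<mu> \<and> \<sigma> j = m" if m: "m \<in> set M" for m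
  proof -
    obtain i where i: "i < length M" "M ! i = m"
      using m by (meson in_set_conv_nth)
    have "\<gamma> + i + 1 \<in> {1..n} \<and> \<gamma> < \<gamma> + i + 1 \<and> \<gamma> + i + 1 < \<mu>"
      using i(1) n by (simp add: \<gamma>_def \<mu>_def)
    moreover have "\<sigma> (\<gamma> + i + 1) = m"
      using i by (simp add: \<sigma>_def zs_def \<gamma>_def nth_append)
    ultimately show ?thesis by blast
  qed
  have T: "sorted_wrt (row_ge A) T" and L: "sorted_wrt (row_ge A) L"
    and T_above_L: "\<And>t l. t \<in> set T \<Longrightarrow> l \<in> set L \<Longrightarrow> row_ge A t l"
    using TL by (auto simp: sorted_wrt_append)
  \<comment> \<open>For \<open>i < j\<close> the last condition excludes only pairs with both
    positions in the middle block. This one fact serves both order conditions and the comparison of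
    row sums.\<close>
  have outer: "row_ge A (\<sigma> i) (\<sigma> j)" if ij: "1 \<le> i" "i < j" "j \<le> n" "i \<le> \<gamma> \<or> \<mu> \<le> j" for i j
  proof -
    consider "j \<le> \<gamma>" | "i \<le> \<gamma>" "\<gamma> < j" "j < \<mu>" | "i \<le> \<gamma>" "\<mu> \<le> j"
      | "\<gamma> < i" "i < \<mu>" "\<mu> \<le> j" | "\<mu> \<le> i"
      using ij by linarith
    then show ?thesis
    proof cases
      case 1
      then show ?thesis
        using ij sorted_wrt_nth_less[OF T, of "i - 1" "j - 1"]
        by (auto simp: \<sigma>_def zs_def \<gamma>_def nth_append)
    next
      case 2
      then show ?thesis using ij T_above_M inT inM by blast
    next
      case 3
      then show ?thesis using ij T_above_L inT inL by blast
    next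
      case 4
      then show ?thesis using ij M_above_L inM inL by blast
    next
      case 5
      \<comment> \<open>These make \<open>nth_append\<close> skip \<open>T\<close> and
        \<open>M\<close>, so that both entries are looked up in \<open>L\<close>.\<close>
      have "\<not> i - 1 < length T" "\<not> i - 1 - length T < length M"
        "\<not> j - 1 < length T" "\<not> j - 1 - length T < length M"
        using 5 ij by (auto simp: \<mu>_def)
      then show ?thesis
        using 5 ij n sorted_wrt_nth_less[OF L, of "i - 1 - length T - length M"
            "j - 1 - length T - length M"]
        by (auto simp: \<sigma>_def zs_def \<mu>_def nth_append)
    qed
  qed
  \<comment> \<open>For \<open>j = \<gamma>\<close> the next row already lies outside
    \<open>T\<close>, which \<open>outer\<close> still covers; \<open>\<mu> \<le> j\<close> gives
    \<open>\<mu> \<le> j + 1\<close>.\<close>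
  have order: "row_ge B j (j + 1)" if "j \<in> {1..n}" "j + 1 \<in> {1..n}" "j \<le> \<gamma> \<or> \<mu> \<le> j" for j
    using that unfolding row_B by (intro outer) auto
  have middle: "(\<forall>r\<^sub>1\<in>{1..n}. r\<^sub>1 \<le> \<gamma> \<longrightarrow> row_ge B r\<^sub>1 j) \<and>
      (\<forall>r\<^sub>2\<in>{1..n}. \<mu> \<le> r\<^sub>2 \<longrightarrow> row_ge B j r\<^sub>2)" if "j \<in> {1..n}" "\<gamma> < j" "j < \<mu>" for j
    using that unfolding row_B by (auto intro!: outer)
  have no_extremal: "\<not> (\<exists>\<alpha>\<in>{1..n}. \<gamma> < \<alpha> \<and> \<alpha> < \<mu> \<and>
      ((\<forall>j\<in>{1..n}. \<gamma> < j \<and> j < \<mu> \<longrightarrow> row_ge B \<alpha> j) \<or>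
       (\<forall>j\<in>{1..n}. \<gamma> < j \<and> j < \<mu> \<longrightarrow> row_ge B j \<alpha>)))"
  proof
    assume "\<exists>\<alpha>\<in>{1..n}. \<gamma> < \<alpha> \<and> \<alpha> < \<mu> \<and>
      ((\<forall>j\<in>{1..n}. \<gamma> < j \<and> j < \<mu> \<longrightarrow> row_ge B \<alpha> j) \<or>
       (\<forall>j\<in>{1..n}. \<gamma> < j \<and> j < \<mu> \<longrightarrow> row_ge B j \<alpha>))"
    then obtain \<alpha> where \<alpha>: "\<gamma> < \<alpha>" "\<alpha> < \<mu>"
      "(\<forall>j\<in>{1..n}. \<gamma> < j \<and> j < \<mu> \<longrightarrow> row_ge A (\<sigma> \<alpha>) (\<sigma> j)) \<or>
       (\<forall>j\<in>{1..n}. \<gamma> < j \<and> j < \<mu> \<longrightarrow> row_ge A (\<sigma> j) (\<sigma> \<alpha>))"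
      unfolding row_B by blast
    \<comment> \<open>By \<open>setM\<close>, such an \<open>\<alpha>\<close> would yield an element
      of \<open>M\<close> that could still be peeled off.\<close>
    have "(\<forall>m\<in>set M. row_ge A (\<sigma> \<alpha>) m) \<or> (\<forall>m\<in>set M. row_ge A m (\<sigma> \<alpha>))"
      using \<alpha>(3) setM by fast
    then show False using extr inM[OF \<alpha>(1,2)] by blast
  qed
  have "B \<in> row_rearrangements n A"
    using bij unfolding row_rearrangements_def B_def by blast
  then have "B \<in> ordered_rearrangements n A \<gamma> \<mu>"
    unfolding ordered_rearrangements_def using order middle no_extremal by simp
  moreover have "\<mu> \<in> {\<gamma>..n + 1}"
    by (simp add: n \<gamma>_def \<mu>_def)
  moreover have "decreasing_upto n (mat_apply B x)"
    unfolding decreasing_upto_def sum_B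
  proof (intro allI impI)
    fix j assume j: "1 \<le> j \<and> j < n"
    show "mat_apply A x (\<sigma> (j + 1)) \<le> mat_apply A x (\<sigma> j)"
    \<comment> \<open>Two neighbours inside the middle block are ordered by the sorting of
      \<open>M\<close>. Otherwise \<open>j \<le> \<gamma>\<close> or
      \<open>\<mu> \<le> j + 1\<close>, and \<open>outer\<close> gives entrywise domination, also
      across the borders of the block.\<close>
    proof (cases "\<gamma> < j \<and> j + 1 < \<mu>")
      case True
      then show ?thesis
        using sorted_wrt_nth_less[OF M, of "j - 1 - length T" "j - length T"]
        by (auto simp: \<sigma>_def zs_def \<gamma>_def \<mu>_def nth_append)
    next
      case False
      then show ?thesis
        using j assms(2) by (intro mat_apply_mono outer) auto
    qed
  qed
  ultimately show ?thesis by blast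
qed

end
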